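(* For every $d\in\mathbb{N}$, $D(k,[k]^d)=1-2k^{-1}-O(k^{-2})$ as $k\to\infty$ with $d$ fixed. That is, for every $d\in\mathbb{N}$ there are constants $C=C(d)>0$ and $N=N(d)\in\mathbb{N}$ such that $\left|D(k,[k]^d)-\left(1-\frac{2}{k}\right)\right|\le \frac{C}{k^2}$ for all integers $k\ge N$.
   Context: Notation: $\mathbb{N}=\{1,2,3,\dots\}$, $[n]=\{1,\dots,n\}$. Let $k\ge 3$ and $d\ge 1$ be integers. The board $B=[k]^d\subseteq\mathbb{Z}^d$ has as its $k$-lines all sets $\{p+j\vec v: 0\le j\le k-1\}$ with $p\in B$ and $\vec v\in\{-1,0,1\}^d\setminus\{0\}$ that are contained in $B$. A configuration of $B$ is a subset $S\subseteq B$ with $|L\setminus S|\ge 2$ for every $k$-line $L$ of $B$. A saturated configuration is a configuration that is maximal with respect to inclusion among configurations; $\mathcal{S}_k(B)$ is the set of saturated configurations. Define $D(k,B)=\max_{S\in\mathcal{S}_k(B)}|S|/|B|$. *)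

theory Defs
  imports Complex_Main "HOL-Library.FuncSet"
begin

(* Points of \<int>^d are the functions nat \<Rightarrow> int that are extensional on {1..d},
   so that equality of points is equality of their d coordinates and cardinalities are correct. *)

definition board :: "nat \<Rightarrow> nat \<Rightarrow> (nat \<Rightarrow> int) set" where
  "board k d = {1..d} \<rightarrow>\<^sub>E {1..int k}"

definition directions :: "nat \<Rightarrow> (nat \<Rightarrow> int) set" where
  "directions d = ({1..d} \<rightarrow>\<^sub>E {-1, 0, 1}) - {\<lambda>i\<in>{1..d}. 0}"

definition line :: "nat \<Rightarrow> nat \<Rightarrow> (nat \<Rightarrow> int) \<Rightarrow> (nat \<Rightarrow> int) \<Rightarrow> (nat \<Rightarrow> int) set" where
  "line k d p v = {(\<lambda>i\<in>{1..d}. p i + int j * v i) | j. j < k}"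

definition k_lines :: "nat \<Rightarrow> nat \<Rightarrow> (nat \<Rightarrow> int) set \<Rightarrow> (nat \<Rightarrow> int) set set" where
  "k_lines k d B = {line k d p v | p v. p \<in> B \<and> v \<in> directions d \<and> line k d p v \<subseteq> B}"

definition configuration :: "nat \<Rightarrow> nat \<Rightarrow> (nat \<Rightarrow> int) set \<Rightarrow> (nat \<Rightarrow> int) set \<Rightarrow> bool" where
  "configuration k d B S \<longleftrightarrow> S \<subseteq> B \<and> (\<forall>L\<in>k_lines k d B. 2 \<le> card (L - S))"

definition saturated :: "nat \<Rightarrow> nat \<Rightarrow> (nat \<Rightarrow> int) set \<Rightarrow> (nat \<Rightarrow> int) set set" where
  "saturated k d B = {S. configuration k d B S \<and> (\<forall>T. configuration k d B T \<and> S \<subseteq> T \<longrightarrow> T = S)}"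

definition max_density :: "nat \<Rightarrow> nat \<Rightarrow> (nat \<Rightarrow> int) set \<Rightarrow> real" where
  "max_density k d B = Max ((\<lambda>S. real (card S) / real (card B)) ` saturated k d B)"

lemma finite_board: "finite (board k d)"
  unfolding board_def by (intro finite_PiE) auto

lemma finite_saturated: "finite B \<Longrightarrow> finite (saturated k d B)"
  by (rule finite_subset[of _ "Pow B"]) (auto simp: saturated_def configuration_def)

lemma card_line:
  assumes "v \<in> directions d"
  shows "card (line k d p v) = k"
proof -
  obtain i where i: "i \<in> {1..d}" "v i \<noteq> 0"
  proof (rule ccontr)
    assume "\<not> thesis"
    with that have "\<forall>i\<in>{1..d}. v i = 0" by blast
    with assms have "v = (\<lambda>i\<in>{1..d}. 0)"
      by (intro extensionalityI[of _ "{1..d}"]) (auto simp: directions_def PiE_def)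
    with assms show False by (simp add: directions_def)
  qed
  have "inj_on (\<lambda>j. \<lambda>i\<in>{1..d}. p i + int j * v i) {..<k}"
  proof (rule inj_onI)
    fix a b
    assume "(\<lambda>i\<in>{1..d}. p i + int a * v i) = (\<lambda>i\<in>{1..d}. p i + int b * v i)"
    from fun_cong[OF this, of i] i show "a = b" by simp
  qed
  moreover have "line k d p v = (\<lambda>j. \<lambda>i\<in>{1..d}. p i + int j * v i) ` {..<k}"
    by (auto simp: line_def)
  ultimately show ?thesis by (simp add: card_image)
qed

lemma saturated_nonempty:
  assumes "finite B" "2 \<le> k"
  shows "saturated k d B \<noteq> {}"
proof -
  let ?C = "{S. configuration k d B S}"
  have "finite ?C"
    by (rule finite_subset[of _ "Pow B"]) (auto simp: configuration_def assms)
  moreover have "{} \<in> ?C"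
    using assms by (auto simp: configuration_def k_lines_def card_line)
  ultimately obtain S where "S \<in> ?C" "\<forall>T\<in>?C. S \<subseteq> T \<longrightarrow> S = T"
    using finite_has_maximal[of ?C] by blast
  then have "S \<in> saturated k d B" by (auto simp: saturated_def)
  then show ?thesis by blast
qed

end

theory Submission
  imports Defs
begin

text \<open>
  Counting missed points, the claim is that the smallest set \<open>T \<subseteq> [k]\<^sup>d\<close> meeting every
  \<open>k\<close>-line in at least two points has size \<open>2k\<^sup>d\<^sup>-\<^sup>1 + O(k\<^sup>d\<^sup>-\<^sup>2)\<close>.

  The board is partitioned into \<open>k\<^sup>d\<^sup>-\<^sup>1\<close> lines parallel to the last axis, and \<open>T\<close> has two points
  on each of them, so \<open>2k\<^sup>d\<^sup>-\<^sup>1\<close> points are necessary (\<open>card_configuration_le\<close>).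

  Conversely, the points whose coordinate sum is \<open>0\<close> or \<open>1\<close> modulo \<open>k\<close> number \<open>2k\<^sup>d\<^sup>-\<^sup>1\<close>, and
  every axis-parallel line contains exactly two of them, since the coordinate sum runs through all
  residues along such a line. The remaining lines move in at least two coordinates. Because a
  \<open>k\<close>-line fits into the board only if it runs from one side to the other in each coordinate
  that moves, both its end points have at least two coordinates in \<open>{1, k}\<close>. There are only
  \<open>O(k\<^sup>d\<^sup>-\<^sup>2)\<close> points of this kind (\<open>card_corners\<close>), so all of them can be added to \<open>T\<close>
  (\<open>configuration_minus_blocker\<close>).
\<close>

section \<open>Boards and maximal density\<close>

lemma card_PiE_fixed_coordinates:
  assumes "F \<subseteq> {1..d}"
  shows "card (PiE {1..d} (\<lambda>m. if m \<in> F then A else {1..int k}))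
    = card A ^ card F * k ^ (d - card F)"
proof -
  have "card (PiE {1..d} (\<lambda>m. if m \<in> F then A else {1..int k}))
      = (\<Prod>m\<in>{1..d}. if m \<in> F then card A else k)"
    by (subst card_PiE) (auto intro!: prod.cong)
  also have "\<dots> = card A ^ card ({1..d} \<inter> F) * k ^ card ({1..d} - F)"
    by (simp add: prod.If_cases Diff_eq)
  also have "{1..d} \<inter> F = F"
    using assms by blast
  also have "card ({1..d} - F) = d - card F"
    using assms by (simp add: card_Diff_subset finite_subset)
  finally show ?thesis .
qed

lemma card_board: "card (board k d) = k ^ d"
  using card_PiE_fixed_coordinates[of "{}" d "{}" k] by (simp add: board_def)

definition facet :: "nat \<Rightarrow> nat \<Rightarrow> (nat \<Rightarrow> int) set" where
  "facet k d = PiE {1..d} (\<lambda>m. if m \<in> {d} then {1} else {1..int k})"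

lemma card_facet: "1 \<le> d \<Longrightarrow> card (facet k d) = k ^ (d - 1)"
  using card_PiE_fixed_coordinates[of "{d}" d "{1}" k] by (simp add: facet_def)

lemma finite_facet: "finite (facet k d)"
  unfolding facet_def by (intro finite_PiE) auto

lemma project_facet:
  assumes "x \<in> board k d" "1 \<le> d"
  shows "x(d := 1) \<in> facet k d"
  using assms by (auto simp: board_def facet_def PiE_iff extensional_def)

lemma configuration_density_le_max_density:
  assumes "finite B" "configuration k d B S"
  shows "real (card S) / real (card B) \<le> max_density k d B"
proof -
  let ?C = "{S. configuration k d B S}"
  have "finite ?C"
    by (rule finite_subset[of _ "Pow B"]) (auto simp: configuration_def assms)
  then obtain T where T: "T \<in> ?C" "S \<subseteq> T" "\<forall>U\<in>?C. T \<subseteq> U \<longrightarrow> T = U"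
    using finite_has_maximal2[of ?C S] assms(2) by auto
  then have "T \<in> saturated k d B"
    by (auto simp: saturated_def)
  then have "real (card T) / real (card B) \<le> max_density k d B"
    unfolding max_density_def using finite_saturated[OF assms(1)] by (intro Max_ge) auto
  moreover have "card S \<le> card T"
    using T assms(1) by (intro card_mono) (auto simp: configuration_def intro: finite_subset)
  ultimately show ?thesis
    by (meson divide_right_mono of_nat_0_le_iff of_nat_mono order_trans)
qed

section \<open>Every configuration misses two points of each axis-parallel line\<close>

text \<open>The lines in the direction of the last axis start at the points of the facet and cover the
  board; a configuration keeps at most \<open>k - 2\<close> points of each.\<close>

lemma card_configuration_le:
  assumes S: "configuration k d (board k d) S" and d: "1 \<le> d"
  shows "card S \<le> (k - 2) * k ^ (d - 1)"
proof -
  define v where "v = (\<lambda>i\<in>{1..d}. if i = d then 1 else 0 :: int)"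
  have "v d = 1" "(\<lambda>i\<in>{1..d}. 0 :: int) d = 0"
    using d by (auto simp: v_def)
  then have "v \<noteq> (\<lambda>i\<in>{1..d}. 0)"
    by (metis zero_neq_one)
  then have v: "v \<in> directions d"
    by (auto simp: directions_def v_def)
  have "S \<subseteq> (\<Union>p\<in>facet k d. S \<inter> line k d p v)"
  proof
    fix x assume "x \<in> S"
    then have x: "x \<in> board k d"
      using S by (auto simp: configuration_def)
    then have xd: "x d \<in> {1..int k}" and ext: "x \<in> extensional {1..d}"
      using d by (auto simp: board_def PiE_iff)
    have "x = (\<lambda>i\<in>{1..d}. (x(d := 1)) i + int (nat (x d - 1)) * v i)"
      using xd d by (intro extensionalityI[OF ext]) (auto simp: v_def)
    moreover have "nat (x d - 1) < k"
      using xd by auto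
    ultimately have "x \<in> line k d (x(d := 1)) v"
      unfolding line_def by blast
    with \<open>x \<in> S\<close> show "x \<in> (\<Union>p\<in>facet k d. S \<inter> line k d p v)"
      using project_facet[OF x d] by blast
  qed
  moreover have fin: "finite (line k d p v)" for p
    by (simp add: line_def)
  ultimately have "card S \<le> card (\<Union>p\<in>facet k d. S \<inter> line k d p v)"
    by (intro card_mono) (auto simp: finite_facet)
  also have "\<dots> \<le> (\<Sum>p\<in>facet k d. card (S \<inter> line k d p v))"
    by (rule card_UN_le[OF finite_facet])
  also have "\<dots> \<le> (\<Sum>p\<in>facet k d. k - 2)"
  proof (rule sum_mono)
    fix p assume p: "p \<in> facet k d"
    then have pd: "p d = 1" and pi: "\<And>i. i \<in> {1..d} \<Longrightarrow> i \<noteq> d \<Longrightarrow> p i \<in> {1..int k}"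
      and pe: "p \<in> extensional {1..d}"
      using d by (auto simp: facet_def PiE_iff split: if_splits)
    show "card (S \<inter> line k d p v) \<le> k - 2"
    proof (cases "k = 0")
      case True
      then show ?thesis by (simp add: line_def)
    next
      case False
      have "p \<in> board k d"
        using False pd pi pe by (force simp: board_def PiE_iff)
      moreover have "line k d p v \<subseteq> board k d"
        using pd pi by (force simp: line_def board_def v_def)
      ultimately have "2 \<le> card (line k d p v - S)"
        using S v unfolding configuration_def k_lines_def by blast
      moreover have "card (line k d p v) = card (line k d p v \<inter> S) + card (line k d p v - S)"
        using fin by (metis card_Int_Diff)
      ultimately show ?thesis
        using card_line[OF v, of k p] by (simp add: Int_commute)
    qed
  qed
  also have "\<dots> = (k - 2) * k ^ (d - 1)"
    by (simp add: card_facet[OF d])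
  finally show ?thesis .
qed

section \<open>Blocking all lines with few points\<close>

definition residue_layer :: "nat \<Rightarrow> nat \<Rightarrow> int \<Rightarrow> (nat \<Rightarrow> int) set" where
  "residue_layer k d c = {x \<in> board k d. (\<Sum>i\<in>{1..d}. x i) mod int k = c}"

definition corners :: "nat \<Rightarrow> nat \<Rightarrow> (nat \<Rightarrow> int) set" where
  "corners k d = {x \<in> board k d.
    \<exists>i\<in>{1..d}. \<exists>j\<in>{1..d}. i \<noteq> j \<and> x i \<in> {1, int k} \<and> x j \<in> {1, int k}}"

text \<open>Projection to the facet is injective here: the residue of the coordinate sum and the other
  coordinates determine the last coordinate modulo \<open>k\<close>, hence as an element of \<open>{1..k}\<close>.\<close>

lemma card_residue_layer:
  assumes d: "1 \<le> d"
  shows "card (residue_layer k d c) \<le> k ^ (d - 1)"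
proof -
  have split: "(\<Sum>i\<in>{1..d}. x i) = x d + (\<Sum>i\<in>{1..d} - {d}. x i)" for x :: "nat \<Rightarrow> int"
    using d by (intro sum.remove) auto
  have "inj_on (\<lambda>x. x(d := 1)) (residue_layer k d c)"
  proof (rule inj_onI)
    fix x y
    assume x: "x \<in> residue_layer k d c" and y: "y \<in> residue_layer k d c"
      and eq: "x(d := 1) = y(d := 1)"
    have other: "x i = y i" if "i \<noteq> d" for i
      using fun_cong[OF eq, of i] that by simp
    then have "(\<Sum>i\<in>{1..d} - {d}. x i) = (\<Sum>i\<in>{1..d} - {d}. y i)"
      by (intro sum.cong) auto
    moreover have "(\<Sum>i\<in>{1..d}. x i) mod int k = (\<Sum>i\<in>{1..d}. y i) mod int k"
      using x y by (simp add: residue_layer_def)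
    ultimately have "int k dvd x d - y d"
      unfolding split by (simp add: mod_eq_dvd_iff)
    moreover have "x d \<in> {1..int k}" "y d \<in> {1..int k}"
      using x y d by (auto simp: residue_layer_def board_def PiE_iff)
    then have "\<bar>x d - y d\<bar> < int k"
      by auto
    ultimately have "x d = y d"
      using dvd_imp_le_int[of "x d - y d" "int k"] by fastforce
    with other show "x = y"
      by (metis ext)
  qed
  moreover have "(\<lambda>x. x(d := 1)) ` residue_layer k d c \<subseteq> facet k d"
    using project_facet[OF _ d] by (auto simp: residue_layer_def)
  ultimately have "card (residue_layer k d c) \<le> card (facet k d)"
    using finite_facet by (rule card_inj_on_le)
  then show ?thesis
    by (simp add: card_facet[OF d])
qed

text \<open>The factor \<open>k\<^sup>2\<close> stands on the left because the exponent \<open>d - 2\<close> would be truncated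
  for \<open>d = 1\<close>, where there are no corners.\<close>

lemma card_corners: "card (corners k d) * k\<^sup>2 \<le> 4 * d\<^sup>2 * k ^ d"
proof -
  define P where "P = {(i, j). i \<in> {1..d} \<and> j \<in> {1..d} \<and> i \<noteq> j}"
  define Q where "Q = (\<lambda>(i, j). PiE {1..d} (\<lambda>m. if m \<in> {i, j} then {1, int k} else {1..int k}))"
  have P: "P \<subseteq> {1..d} \<times> {1..d}"
    by (auto simp: P_def)
  then have finP: "finite P"
    by (rule finite_subset) auto
  have finQ: "finite (Q q)" for q
    by (auto simp: Q_def split: prod.splits intro!: finite_PiE)
  have Q: "card (Q q) * k\<^sup>2 \<le> 4 * k ^ d" if q_mem: "q \<in> P" for q
  proof -
    obtain i j where q: "q = (i, j)" and ij: "i \<in> {1..d}" "j \<in> {1..d}" "i \<noteq> j"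
      using q_mem by (auto simp: P_def)
    then have "card {i, j} \<le> card {1..d}"
      by (intro card_mono) auto
    then have "2 \<le> d"
      using ij by simp
    have "card (Q q) = card {1, int k} ^ 2 * k ^ (d - 2)"
      using card_PiE_fixed_coordinates[of "{i, j}" d "{1, int k}" k] ij
      by (simp add: Q_def q numeral_2_eq_2)
    also have "\<dots> \<le> 2\<^sup>2 * k ^ (d - 2)"
      by (intro mult_right_mono power_mono) (auto simp: card_insert_if)
    finally have "card (Q q) * k\<^sup>2 \<le> 4 * k ^ (d - 2) * k\<^sup>2"
      by simp
    also have "\<dots> = 4 * k ^ d"
      using \<open>2 \<le> d\<close> by (metis le_add_diff_inverse2 mult.assoc power_add)
    finally show ?thesis .
  qed
  have "corners k d \<subseteq> (\<Union>q\<in>P. Q q)"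
  proof
    fix x assume "x \<in> corners k d"
    then obtain i j where "(i, j) \<in> P" "x \<in> board k d" "x i \<in> {1, int k}" "x j \<in> {1, int k}"
      by (auto simp: corners_def P_def)
    moreover from this have "x \<in> Q (i, j)"
      by (auto simp: Q_def board_def PiE_iff)
    ultimately show "x \<in> (\<Union>q\<in>P. Q q)"
      by blast
  qed
  then have "card (corners k d) \<le> card (\<Union>q\<in>P. Q q)"
    using finP finQ by (intro card_mono) auto
  also have "\<dots> \<le> (\<Sum>q\<in>P. card (Q q))"
    by (rule card_UN_le[OF finP])
  finally have "card (corners k d) * k\<^sup>2 \<le> (\<Sum>q\<in>P. card (Q q) * k\<^sup>2)"
    by (simp flip: sum_distrib_right)
  also have "\<dots> \<le> (\<Sum>q\<in>P. 4 * k ^ d)"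
    by (rule sum_mono) (rule Q)
  also have "\<dots> = card P * (4 * k ^ d)"
    by simp
  also have "\<dots> \<le> d\<^sup>2 * (4 * k ^ d)"
    using card_mono[OF _ P]
    by (intro mult_right_mono) (auto simp: card_cartesian_product power2_eq_square)
  finally show ?thesis
    by (simp add: mult.commute mult.left_commute)
qed

text \<open>If only coordinate \<open>i\<close> moves, the coordinate sum changes by \<open>v i = \<plusminus>1\<close> at each step, so
  it takes every residue within \<open>k\<close> steps.\<close>

lemma axis_line_meets_residue_layer:
  assumes L: "line k d p v \<subseteq> board k d" and v: "v \<in> directions d"
    and i: "i \<in> {1..d}" "\<And>j. j \<in> {1..d} \<Longrightarrow> v j \<noteq> 0 \<Longrightarrow> j = i" "v i \<noteq> 0"
    and c: "0 \<le> c" "c < int k"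
  shows "\<exists>x. x \<in> line k d p v \<inter> residue_layer k d c"
proof -
  define s where "s = (\<Sum>m\<in>{1..d}. p m)"
  define j where "j = nat (((c - s) * v i) mod int k)"
  define x where "x = (\<lambda>m\<in>{1..d}. p m + int j * v m)"
  have j: "int j = ((c - s) * v i) mod int k" "j < k"
    using c by (auto simp: j_def nat_less_iff)
  then have x: "x \<in> line k d p v"
    unfolding line_def x_def by blast
  have "v i \<in> {-1, 0, 1}"
    using v i(1) by (auto simp: directions_def)
  then have sq: "v i * v i = 1"
    using i(3) by auto
  have "(\<Sum>m\<in>{1..d}. v m) = (\<Sum>m\<in>{1..d}. if m = i then v i else 0)"
    using i(2) by (intro sum.cong) auto
  then have sum_v: "(\<Sum>m\<in>{1..d}. v m) = v i"
    using i(1) by simp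
  have "(\<Sum>m\<in>{1..d}. x m) = s + int j * v i"
    by (simp add: x_def s_def sum.distrib flip: sum_distrib_left sum_v)
  then have "(\<Sum>m\<in>{1..d}. x m) mod int k = (s + (c - s) * v i * v i) mod int k"
    unfolding j(1) by (metis mod_add_right_eq mod_mult_left_eq)
  also have "s + (c - s) * v i * v i = c"
    by (simp add: mult.assoc sq)
  finally have "x \<in> residue_layer k d c"
    using x L c by (auto simp: residue_layer_def)
  with x show ?thesis
    by blast
qed

text \<open>In a coordinate where it moves, a line covers \<open>k\<close> consecutive values inside \<open>{1..k}\<close>, so
  it starts and ends at extreme values.\<close>

lemma line_ends_extreme:
  assumes L: "line k d p v \<subseteq> board k d" and v: "v \<in> directions d" and k: "1 \<le> k"
    and i: "i \<in> {1..d}" "v i \<noteq> 0" and j: "j \<in> {0, k - 1}"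
  shows "p i + int j * v i \<in> {1, int k}"
proof -
  have bounds: "p i + int m * v i \<in> {1..int k}" if "m < k" for m
  proof -
    have "(\<lambda>i\<in>{1..d}. p i + int m * v i) \<in> board k d"
      using L that by (auto simp: line_def)
    from PiE_mem[OF this[unfolded board_def] i(1)] show ?thesis
      using i(1) by simp
  qed
  have "v i \<in> {-1, 0, 1}"
    using v i(1) by (auto simp: directions_def)
  with bounds[of 0] bounds[of "k - 1"] i(2) j k show ?thesis
    by auto
qed

definition blocker :: "nat \<Rightarrow> nat \<Rightarrow> (nat \<Rightarrow> int) set" where
  "blocker k d = residue_layer k d 0 \<union> residue_layer k d 1 \<union> corners k d"

lemma finite_blocker: "finite (blocker k d)"
  by (rule finite_subset[OF _ finite_board[of k d]])
    (auto simp: blocker_def residue_layer_def corners_def)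

lemma line_meets_blocker_twice:
  assumes L: "line k d p v \<subseteq> board k d" and v: "v \<in> directions d" and k: "2 \<le> k"
  shows "\<exists>x y. x \<noteq> y \<and> {x, y} \<subseteq> line k d p v \<inter> blocker k d"
proof -
  have "\<exists>i\<in>{1..d}. v i \<noteq> 0"
  proof (rule ccontr)
    assume "\<not> ?thesis"
    with v have "v = (\<lambda>i\<in>{1..d}. 0)"
      by (intro extensionalityI[of _ "{1..d}"]) (auto simp: directions_def PiE_def)
    with v show False
      by (simp add: directions_def)
  qed
  then obtain i where i: "i \<in> {1..d}" "v i \<noteq> 0"
    by blast
  show ?thesis
  proof (cases "\<exists>j\<in>{1..d}. v j \<noteq> 0 \<and> j \<noteq> i")
    case True
    then obtain j where j: "j \<in> {1..d}" "v j \<noteq> 0" "j \<noteq> i"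
      by blast
    define e where "e m = (\<lambda>i\<in>{1..d}. p i + int m * v i)" for m
    have "e m \<in> line k d p v \<inter> corners k d" if m: "m \<in> {0, k - 1}" for m
    proof
      have "m < k"
        using m k by auto
      then show e_line: "e m \<in> line k d p v"
        by (auto simp: line_def e_def)
      have "e m i \<in> {1, int k}" "e m j \<in> {1, int k}"
        using line_ends_extreme[OF L v _ _ _ m] i j k by (simp_all add: e_def)
      then show "e m \<in> corners k d"
        using e_line L i(1) j unfolding corners_def by blast
    qed
    moreover have "e 0 i \<noteq> e (k - 1) i"
      using i k by (simp add: e_def)
    then have "e 0 \<noteq> e (k - 1)"
      by auto
    ultimately show ?thesis
      by (intro exI[of _ "e 0"] exI[of _ "e (k - 1)"]) (auto simp: blocker_def)
  next
    case False
    then have axis: "\<And>j. j \<in> {1..d} \<Longrightarrow> v j \<noteq> 0 \<Longrightarrow> j = i"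
      by blast
    obtain x y where "x \<in> line k d p v \<inter> residue_layer k d 0"
      "y \<in> line k d p v \<inter> residue_layer k d 1"
      using axis_line_meets_residue_layer[OF L v i(1) axis i(2), of 0]
        axis_line_meets_residue_layer[OF L v i(1) axis i(2), of 1] k by auto
    then show ?thesis
      by (intro exI[of _ x] exI[of _ y]) (auto simp: blocker_def residue_layer_def)
  qed
qed

lemma configuration_minus_blocker:
  assumes k: "2 \<le> k"
  shows "configuration k d (board k d) (board k d - blocker k d)"
  unfolding configuration_def
proof (intro conjI ballI)
  fix L assume "L \<in> k_lines k d (board k d)"
  then obtain p v where L: "L = line k d p v" "L \<subseteq> board k d" "v \<in> directions d"
    by (auto simp: k_lines_def)
  with line_meets_blocker_twice[OF _ _ k] obtain x y
    where xy: "x \<noteq> y" "{x, y} \<subseteq> L \<inter> blocker k d"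
    by metis
  then have "card {x, y} \<le> card (L - (board k d - blocker k d))"
    using L(2) finite_board[of k d] by (intro card_mono) (auto intro: finite_subset)
  then show "2 \<le> card (L - (board k d - blocker k d))"
    using xy(1) by simp
qed auto

lemma card_blocker:
  assumes "1 \<le> d" "1 \<le> k"
  shows "real (card (blocker k d)) / real k ^ d \<le> 2 / real k + 4 * (real d)\<^sup>2 / (real k)\<^sup>2"
proof -
  have k: "real k > 0"
    using assms(2) by simp
  have "card (blocker k d)
      \<le> card (residue_layer k d 0) + card (residue_layer k d 1) + card (corners k d)"
    unfolding blocker_def by (metis add_le_mono1 card_Un_le order_trans)
  also have "\<dots> \<le> 2 * k ^ (d - 1) + card (corners k d)"
    using card_residue_layer[OF assms(1), of k 0] card_residue_layer[OF assms(1), of k 1] by simp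
  finally have "card (blocker k d) \<le> 2 * k ^ (d - 1) + card (corners k d)" .
  then have "real (card (blocker k d)) \<le> 2 * real k ^ (d - 1) + real (card (corners k d))"
    using of_nat_mono[where 'a = real] by fastforce
  then have "real (card (blocker k d)) / real k ^ d
      \<le> (2 * real k ^ (d - 1) + real (card (corners k d))) / real k ^ d"
    by (intro divide_right_mono) auto
  also have "\<dots> = 2 / real k + real (card (corners k d)) / real k ^ d"
    using k assms(1) by (cases d) (auto simp: add_divide_distrib)
  also have "\<dots> \<le> 2 / real k + 4 * (real d)\<^sup>2 / (real k)\<^sup>2"
  proof -
    have "real (card (corners k d) * k\<^sup>2) \<le> real (4 * d\<^sup>2 * k ^ d)"
      by (rule of_nat_mono[OF card_corners])
    then show ?thesis
      using k by (simp add: field_simps)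
  qed
  finally show ?thesis .
qed

theorem mainTheorem4:
  shows "\<forall>d::nat. d \<ge> 1 \<longrightarrow>
    (\<exists>C::real. C > 0 \<and> (\<exists>N::nat. N \<ge> 3 \<and>
      (\<forall>k::nat. k \<ge> N \<longrightarrow>
        \<bar>max_density k d (board k d) - (1 - 2 / real k)\<bar> \<le> C / (real k)\<^sup>2)))"
proof (intro allI impI)
  fix d :: nat assume d: "d \<ge> 1"
  have bound: "\<bar>max_density k d (board k d) - (1 - 2 / real k)\<bar> \<le> 4 * (real d)\<^sup>2 / (real k)\<^sup>2"
    if "k \<ge> 3" for k
  proof -
    let ?B = "board k d" and ?D = "max_density k d (board k d)"
    have k: "real k > 0"
      using that by simp
    have "real (card S) / real (card ?B) \<le> 1 - 2 / real k" if "S \<in> saturated k d ?B" for S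
    proof -
      have "card S \<le> (k - 2) * k ^ (d - 1)"
        using that by (intro card_configuration_le d) (simp add: saturated_def)
      then have "real (card S) \<le> real ((k - 2) * k ^ (d - 1))"
        by (rule of_nat_mono)
      also have "\<dots> = (real k - 2) * real k ^ (d - 1)"
        using \<open>k \<ge> 3\<close> by simp
      finally have "real (card S) / real k ^ d \<le> (real k - 2) * real k ^ (d - 1) / real k ^ d"
        by (intro divide_right_mono) auto
      also have "\<dots> = 1 - 2 / real k"
        using k d by (cases d) (auto simp: diff_divide_distrib)
      finally show ?thesis
        by (simp add: card_board)
    qed
    then have upper: "?D \<le> 1 - 2 / real k"
      unfolding max_density_def
      using finite_saturated[OF finite_board] saturated_nonempty[OF finite_board] \<open>k \<ge> 3\<close>
      by (subst Max_le_iff) auto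
    have "real k ^ d \<le> real (card (?B - blocker k d)) + real (card (blocker k d))"
      using diff_card_le_card_Diff[OF finite_blocker, of ?B k d]
      by (simp add: card_board flip: of_nat_power of_nat_add)
    then have "(real k ^ d - real (card (blocker k d))) / real k ^ d
        \<le> real (card (?B - blocker k d)) / real k ^ d"
      by (intro divide_right_mono) auto
    then have "1 - real (card (blocker k d)) / real k ^ d
        \<le> real (card (?B - blocker k d)) / real (card ?B)"
      using k by (simp add: card_board diff_divide_distrib)
    also have "\<dots> \<le> ?D"
      using \<open>k \<ge> 3\<close>
      by (intro configuration_density_le_max_density finite_board configuration_minus_blocker) simp
    finally have "1 - 2 / real k - 4 * (real d)\<^sup>2 / (real k)\<^sup>2 \<le> ?D"
      using card_blocker[OF d, of k] \<open>k \<ge> 3\<close> by simp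
    with upper show ?thesis
      by (simp add: abs_le_iff)
  qed
  show "\<exists>C::real. C > 0 \<and> (\<exists>N::nat. N \<ge> 3 \<and>
      (\<forall>k::nat. k \<ge> N \<longrightarrow>
        \<bar>max_density k d (board k d) - (1 - 2 / real k)\<bar> \<le> C / (real k)\<^sup>2))"
    using bound d by (intro exI[of _ "4 * (real d)\<^sup>2"] conjI exI[of _ 3]) auto
qed

end
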